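(* For every integer $d\geq 1$ let $X,Y$ be independent random vectors in $\mathbb{R}^d$ with $X,Y\sim\mathcal{N}(0,1,\mathbb{R}^d)$. Then: (i) for all $d\geq 1$: $\mathrm{E}\bigl(\|X-Y\|-\sqrt{2d}\bigr)\leq \frac{1}{\sqrt{2d}}$; (ii) for all $d\geq 1$: $\mathrm{V}(\|X-Y\|)\leq 3$.
   Context: $\mathcal{N}(0,1,\mathbb{R}^d)$ denotes the spherical Gaussian distribution on $\mathbb{R}^d$ with mean zero and unit variance, i.e. with density $(2\pi)^{-d/2}\exp(-\|x\|^2/2)$ with respect to Lebesgue measure. $\|\cdot\|$ is the Euclidean norm, $\mathrm{E}$ the expectation and $\mathrm{V}$ the variance. *)

theory Defs
  imports "HOL-Probability.Probability"
begin

definition std_gaussian_density :: "real ^ 'n::finite \<Rightarrow> real" where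
  "std_gaussian_density x =
     (2 * pi) powr (- real CARD('n) / 2) * exp (- (norm x)\<^sup>2 / 2)"

end

theory Submission
  imports Defs
begin

text \<open>
  The difference \<open>Z = X - Y\<close> has a density proportional to \<open>exp (- \<parallel>z\<parallel>\<^sup>2 / 4)\<close>
  (lemma \<open>difference_of_std_gaussians\<close>), and everything
  else follows from how such a density behaves under dilations.  Write
  \<open>R = \<parallel>Z\<parallel>\<close>, let \<open>d\<close> be the dimension and let the density be \<open>K exp (- b \<parallel>z\<parallel>\<^sup>2)\<close>; the case
  of interest is \<open>b = 1/4\<close>.

  The substitution \<open>z \<mapsto> l z\<close> in the Gaussian integral (lemma \<open>gaussian_dilation\<close>) reads
  \<open>l\<^sup>d E f(l Z) = E [exp (b (1 - 1/l\<^sup>2) R\<^sup>2) f(Z)]\<close>.  Differentiating at \<open>l = 1\<close> for \<open>f\<close> homogeneous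
  of degree \<open>p\<close> gives the virial identity \<open>2 b E [R\<^sup>2 f(Z)] = (d + p) E f(Z)\<close>.  It is needed for two
  functions and in one direction only, so instead of differentiating under the integral one
  bounds the exponential by \<open>exp x \<ge> 1 + x\<close> and lets \<open>l\<close> tend to 1.

  \<^item> For \<open>f = 1\<close> it yields \<open>E R\<^sup>2 \<le> d / (2 b)\<close> (lemma \<open>gaussian_second_moment\<close>).

  \<^item> For \<open>f = 1 / R\<close> it yields \<open>E R \<ge> (d - 1) / (2 b) E (1 / R)\<close> (lemma \<open>gaussian_reciprocal_norm\<close>).
    By Jensen's inequality \<open>E (1 / R) \<ge> 1 / E R\<close>, hence \<open>(E R)\<^sup>2 \<ge> (d - 1) / (2 b)\<close>
    (lemma \<open>gaussian_mean_norm_lower_bound\<close>).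

  Subtracting, the variance of \<open>R\<close> is at most \<open>1 / (2 b) = 2\<close>.  As the variance is also
  nonnegative, \<open>(E R)\<^sup>2 \<le> E R\<^sup>2 \<le> 2 d\<close>, so that the expectation of \<open>R - sqrt (2 d)\<close> is at most 0.
\<close>

section \<open>The difference of two independent Gaussian vectors\<close>

lemma nn_integral_lborel_affine:
  fixes f :: "'b::euclidean_space \<Rightarrow> ennreal"
  assumes [measurable]: "f \<in> borel_measurable borel" and "c \<noteq> 0"
  shows "(\<integral>\<^sup>+x. f x \<partial>lborel) = ennreal (\<bar>c\<bar> ^ DIM('b)) * (\<integral>\<^sup>+x. f (t + c *\<^sub>R x) \<partial>lborel)"
  by (subst lborel_affine[OF \<open>c \<noteq> 0\<close>, of t])
     (simp add: nn_integral_density nn_integral_distr nn_integral_cmult)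

text \<open>
  Two shears replace a rotation of the product space: substituting \<open>x = y + z\<close> and completing the
  square, \<open>\<parallel>y + z\<parallel>\<^sup>2 / 2 + \<parallel>y\<parallel>\<^sup>2 / 2 = \<parallel>y + z / 2\<parallel>\<^sup>2 + \<parallel>z\<parallel>\<^sup>2 / 4\<close>, one can translate \<open>z / 2\<close> away
  in the inner integral, which separates the two variables.
\<close>
lemma gaussian_kernel_convolution:
  fixes g :: "'b::euclidean_space \<Rightarrow> ennreal"
  assumes [measurable]: "g \<in> borel_measurable borel"
  shows "(\<integral>\<^sup>+x. \<integral>\<^sup>+y. ennreal (exp (- (norm x)\<^sup>2 / 2) * exp (- (norm y)\<^sup>2 / 2)) * g (x - y) \<partial>lborel \<partial>lborel)
       = (\<integral>\<^sup>+y. ennreal (exp (- (norm (y::'b))\<^sup>2)) \<partial>lborel)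
         * (\<integral>\<^sup>+z. ennreal (exp (- (1/4) * (norm z)\<^sup>2)) * g z \<partial>lborel)"
proof -
  have shift: "(\<integral>\<^sup>+x. h x \<partial>lborel) = (\<integral>\<^sup>+x. h (t + x) \<partial>lborel)"
    if "h \<in> borel_measurable borel" for h :: "'b \<Rightarrow> ennreal" and t
    using nn_integral_lborel_affine[OF that, of 1 t] by simp
  have square: "- (norm (y + z))\<^sup>2 / 2 + - (norm y)\<^sup>2 / 2
      = - (norm ((1/2) *\<^sub>R z + y))\<^sup>2 + - (1/4) * (norm z)\<^sup>2" for y z :: 'b
    by (simp add: power2_norm_eq_inner inner_simps inner_commute field_simps)
  let ?k = "\<lambda>u y::'b. ennreal (exp (- (norm u)\<^sup>2 / 2) * exp (- (norm y)\<^sup>2 / 2))"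
  have "(\<integral>\<^sup>+x. \<integral>\<^sup>+y. ?k x y * g (x - y) \<partial>lborel \<partial>lborel)
      = (\<integral>\<^sup>+y. \<integral>\<^sup>+x. ?k x y * g (x - y) \<partial>lborel \<partial>lborel)"
    by (rule lborel_pair.Fubini') measurable
  also have "\<dots> = (\<integral>\<^sup>+y. \<integral>\<^sup>+z. ?k (y + z) y * g z \<partial>lborel \<partial>lborel)"
  proof (rule nn_integral_cong)
    fix y :: 'b
    show "(\<integral>\<^sup>+x. ?k x y * g (x - y) \<partial>lborel) = (\<integral>\<^sup>+z. ?k (y + z) y * g z \<partial>lborel)"
      using shift[of "\<lambda>x. ?k x y * g (x - y)" y] by simp
  qed
  also have "\<dots> = (\<integral>\<^sup>+z. \<integral>\<^sup>+y. ?k (y + z) y * g z \<partial>lborel \<partial>lborel)"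
    by (rule lborel_pair.Fubini') measurable
  also have "\<dots> = (\<integral>\<^sup>+z. \<integral>\<^sup>+y. ennreal (exp (- (norm ((1/2) *\<^sub>R z + y))\<^sup>2))
                       * (ennreal (exp (- (1/4) * (norm z)\<^sup>2)) * g z) \<partial>lborel \<partial>lborel)"
  proof (intro nn_integral_cong)
    fix y z :: 'b
    have "?k (y + z) y = ennreal (exp (- (norm ((1/2) *\<^sub>R z + y))\<^sup>2) * exp (- (1/4) * (norm z)\<^sup>2))"
      by (simp only: exp_add[symmetric] square)
    then show "?k (y + z) y * g z = ennreal (exp (- (norm ((1/2) *\<^sub>R z + y))\<^sup>2))
                 * (ennreal (exp (- (1/4) * (norm z)\<^sup>2)) * g z)"
      by (simp only: ennreal_mult exp_ge_zero mult.assoc)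
  qed
  also have "\<dots> = (\<integral>\<^sup>+z. (\<integral>\<^sup>+y. ennreal (exp (- (norm (y::'b))\<^sup>2)) \<partial>lborel)
                       * (ennreal (exp (- (1/4) * (norm z)\<^sup>2)) * g z) \<partial>lborel)"
  proof (rule nn_integral_cong)
    fix z :: 'b
    show "(\<integral>\<^sup>+y. ennreal (exp (- (norm ((1/2) *\<^sub>R z + y))\<^sup>2))
             * (ennreal (exp (- (1/4) * (norm z)\<^sup>2)) * g z) \<partial>lborel)
        = (\<integral>\<^sup>+y. ennreal (exp (- (norm (y::'b))\<^sup>2)) \<partial>lborel) * (ennreal (exp (- (1/4) * (norm z)\<^sup>2)) * g z)"
      by (subst (2) shift[of _ "(1/2) *\<^sub>R z"], measurable) (rule nn_integral_multc, measurable)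
  qed
  also have "\<dots> = (\<integral>\<^sup>+y. ennreal (exp (- (norm (y::'b))\<^sup>2)) \<partial>lborel)
         * (\<integral>\<^sup>+z. ennreal (exp (- (1/4) * (norm z)\<^sup>2)) * g z \<partial>lborel)"
    by (rule nn_integral_cmult) measurable
  finally show ?thesis .
qed

text \<open>
  The constant is left as an unspecified extended nonnegative number, because the dilation
  argument only compares integrals against the same density.
\<close>
lemma (in prob_space) difference_of_std_gaussians:
  fixes X Y :: "'a \<Rightarrow> real ^ 'n"
  assumes X: "distributed M lborel X (\<lambda>x. ennreal (std_gaussian_density x))"
    and Y: "distributed M lborel Y (\<lambda>x. ennreal (std_gaussian_density x))"
    and ind: "indep_var borel X borel Y"
  obtains K where "distributed M lborel (\<lambda>\<omega>. X \<omega> - Y \<omega>)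
                     (\<lambda>z. K * ennreal (exp (- (1/4) * (norm z)\<^sup>2)))"
proof
  define c where "c = (2 * pi) powr (- real CARD('n) / 2)"
  have c0: "c \<ge> 0"
    by (simp add: c_def)
  have dens: "std_gaussian_density x = c * exp (- (norm x)\<^sup>2 / 2)" for x :: "real ^ 'n"
    by (simp add: std_gaussian_density_def c_def)
  have [measurable]: "X \<in> borel_measurable M" "Y \<in> borel_measurable M"
    using X Y by (simp_all add: distributed_def)
  define K where "K = ennreal (c * c) * (\<integral>\<^sup>+y. ennreal (exp (- (norm (y::real^'n))\<^sup>2)) \<partial>lborel)"
  have "indep_var lborel X lborel Y"
    using ind by (simp add: indep_var_distribution_eq cong: distr_cong)
  with X Y have joint: "distributed M (lborel \<Otimes>\<^sub>M lborel) (\<lambda>\<omega>. (X \<omega>, Y \<omega>))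
      (\<lambda>(x, y). ennreal (std_gaussian_density x) * ennreal (std_gaussian_density y))"
    by (intro distributed_joint_indep) (auto intro: lborel.sigma_finite_measure_axioms)
  show "distributed M lborel (\<lambda>\<omega>. X \<omega> - Y \<omega>) (\<lambda>z. K * ennreal (exp (- (1/4) * (norm z)\<^sup>2)))"
    unfolding distributed_def
  proof (intro conjI measure_eqI)
    fix A assume "A \<in> sets (distr M lborel (\<lambda>\<omega>. X \<omega> - Y \<omega>))"
    then have [measurable]: "A \<in> sets borel" by simp
    have "emeasure (distr M lborel (\<lambda>\<omega>. X \<omega> - Y \<omega>)) A = (\<integral>\<^sup>+\<omega>. indicator A (X \<omega> - Y \<omega>) \<partial>M)"
      by (simp add: nn_integral_indicator[symmetric] nn_integral_distr del: nn_integral_indicator)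
    also have "\<dots> = (\<integral>\<^sup>+p. (case p of (x, y) \<Rightarrow> ennreal (std_gaussian_density x) * ennreal (std_gaussian_density y))
                       * indicator A (fst p - snd p) \<partial>(lborel \<Otimes>\<^sub>M lborel))"
      by (subst distributed_nn_integral[OF joint]) auto
    also have "\<dots> = (\<integral>\<^sup>+x. \<integral>\<^sup>+y. ennreal (c * c) * (ennreal (exp (- (norm x)\<^sup>2 / 2) * exp (- (norm y)\<^sup>2 / 2))
                        * indicator A (x - y)) \<partial>lborel \<partial>lborel)"
      unfolding dens
      using c0 by (subst lborel.nn_integral_fst[symmetric])
        (auto intro!: nn_integral_cong simp: ennreal_mult'' ennreal_mult' mult_ac)
    also have "\<dots> = ennreal (c * c) * (\<integral>\<^sup>+x. \<integral>\<^sup>+y. ennreal (exp (- (norm x)\<^sup>2 / 2) * exp (- (norm y)\<^sup>2 / 2))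
                        * indicator A (x - y) \<partial>lborel \<partial>lborel)"
      by (simp add: nn_integral_cmult)
    also have "\<dots> = K * (\<integral>\<^sup>+z. ennreal (exp (- (1/4) * (norm z)\<^sup>2)) * indicator A z \<partial>lborel)"
      by (subst gaussian_kernel_convolution) (auto simp: K_def mult.assoc)
    also have "\<dots> = emeasure (density lborel (\<lambda>z. K * ennreal (exp (- (1/4) * (norm z)\<^sup>2)))) A"
      by (simp add: emeasure_density nn_integral_cmult mult.assoc)
    finally show "emeasure (distr M lborel (\<lambda>\<omega>. X \<omega> - Y \<omega>)) A
        = emeasure (density lborel (\<lambda>z. K * ennreal (exp (- (1/4) * (norm z)\<^sup>2)))) A" .
  qed auto
qed

section \<open>Dilations and the second moment\<close>

lemma (in prob_space) gaussian_dilation: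
  fixes Z :: "'a \<Rightarrow> 'b::euclidean_space" and f :: "'b \<Rightarrow> ennreal"
  assumes Z: "distributed M lborel Z (\<lambda>z. K * ennreal (exp (- b * (norm z)\<^sup>2)))"
    and [measurable]: "f \<in> borel_measurable borel" and "l > 0"
  shows "ennreal (l ^ DIM('b)) * (\<integral>\<^sup>+\<omega>. f (l *\<^sub>R Z \<omega>) \<partial>M)
       = (\<integral>\<^sup>+\<omega>. ennreal (exp (b * (1 - 1 / l\<^sup>2) * (norm (Z \<omega>))\<^sup>2)) * f (Z \<omega>) \<partial>M)"
proof -
  have "(\<integral>\<^sup>+\<omega>. ennreal (exp (b * (1 - 1 / l\<^sup>2) * (norm (Z \<omega>))\<^sup>2)) * f (Z \<omega>) \<partial>M)
      = (\<integral>\<^sup>+z. K * ennreal (exp (- b * (norm z)\<^sup>2))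
            * (ennreal (exp (b * (1 - 1 / l\<^sup>2) * (norm z)\<^sup>2)) * f z) \<partial>lborel)"
    by (subst distributed_nn_integral[OF Z]) auto
  also have "\<dots> = (\<integral>\<^sup>+z. K * ennreal (exp (- b * (norm z)\<^sup>2 / l\<^sup>2)) * f z \<partial>lborel)"
    by (intro nn_integral_cong)
       (simp add: mult.assoc ennreal_mult'[symmetric] exp_add[symmetric] algebra_simps
          flip: mult.assoc[of "ennreal _"])
  also have "\<dots> = ennreal (l ^ DIM('b)) * (\<integral>\<^sup>+z. K * ennreal (exp (- b * (norm z)\<^sup>2)) * f (l *\<^sub>R z) \<partial>lborel)"
    using \<open>l > 0\<close> by (subst nn_integral_lborel_affine[where c = l and t = 0]) (auto simp: power_mult_distrib)
  also have "\<dots> = ennreal (l ^ DIM('b)) * (\<integral>\<^sup>+\<omega>. f (l *\<^sub>R Z \<omega>) \<partial>M)"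
    by (subst distributed_nn_integral[OF Z, of "\<lambda>z. f (l *\<^sub>R z)"]) auto
  finally show ?thesis ..
qed

text \<open>
  Compares, to first order at \<open>l = 1\<close>, the variation of \<open>l\<^sup>m\<close>, which comes from the Jacobian, with that of
  the exponent \<open>1 - 1/l\<^sup>2\<close> in \<open>gaussian_dilation\<close>.  The limit is used from the right for the second
  moment and from the left for the reciprocal norm.
\<close>
lemma power_quotient_tendsto:
  "((\<lambda>l::real. (l ^ m - 1) / (1 - 1 / l\<^sup>2)) \<longlongrightarrow> real m / 2) (at 1)"
proof (rule Lim_transform_eventually)
  show "((\<lambda>l::real. (\<Sum>k<m. l ^ k) * l\<^sup>2 / (l + 1)) \<longlongrightarrow> real m / 2) (at 1)"
    by (auto intro!: tendsto_eq_intros)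
  have "\<forall>\<^sub>F l::real in at 1. l > 0"
    by (rule order_tendstoD) (auto intro!: tendsto_intros)
  moreover have "\<forall>\<^sub>F l::real in at 1. l \<noteq> 1"
    by (simp add: eventually_at_filter)
  ultimately show "\<forall>\<^sub>F l::real in at 1. (\<Sum>k<m. l ^ k) * l\<^sup>2 / (l + 1) = (l ^ m - 1) / (1 - 1 / l\<^sup>2)"
  proof eventually_elim
    case (elim l)
    have "l ^ m - 1 = (l - 1) * (\<Sum>k<m. l ^ k)"
      by (rule power_diff_1_eq)
    moreover have "1 - 1 / l\<^sup>2 = (l - 1) * (l + 1) / l\<^sup>2"
      using elim by (simp add: field_simps power2_eq_square)
    ultimately show ?case
      using elim by simp
  qed
qed

text \<open>
  For \<open>l > 1\<close> the exponent in \<open>gaussian_dilation\<close> is nonnegative, so \<open>exp x \<ge> 1 + x\<close> bounds the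
  second moment by a finite number: a single such \<open>l\<close> gives integrability, and the limit from
  the right gives the sharp constant.
\<close>
lemma (in prob_space) gaussian_second_moment:
  fixes Z :: "'a \<Rightarrow> 'b::euclidean_space"
  assumes Z: "distributed M lborel Z (\<lambda>z. K * ennreal (exp (- b * (norm z)\<^sup>2)))"
    and "b > 0"
  shows "integrable M (\<lambda>\<omega>. (norm (Z \<omega>))\<^sup>2)"
    and "expectation (\<lambda>\<omega>. (norm (Z \<omega>))\<^sup>2) \<le> DIM('b) / (2 * b)"
proof -
  have [measurable]: "Z \<in> borel_measurable M"
    using Z by (simp add: distributed_def)
  define I where "I = (\<integral>\<^sup>+\<omega>. ennreal ((norm (Z \<omega>))\<^sup>2) \<partial>M)"
  have bound: "1 + ennreal (b * (1 - 1 / l\<^sup>2)) * I \<le> ennreal (l ^ DIM('b))" if "l > 1" for l :: real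
  proof -
    define c where "c = b * (1 - 1 / l\<^sup>2)"
    have c: "c \<ge> 0"
      using that \<open>b > 0\<close> by (simp add: c_def one_le_power)
    have "1 + ennreal c * I = (\<integral>\<^sup>+\<omega>. 1 + ennreal c * ennreal ((norm (Z \<omega>))\<^sup>2) \<partial>M)"
      by (simp add: I_def nn_integral_add nn_integral_cmult emeasure_space_1)
    also have "\<dots> \<le> (\<integral>\<^sup>+\<omega>. ennreal (exp (c * (norm (Z \<omega>))\<^sup>2)) \<partial>M)"
      using c exp_ge_add_one_self
      by (intro nn_integral_mono) (simp add: ennreal_mult'[symmetric] flip: ennreal_1 ennreal_plus)
    also have "\<dots> = ennreal (l ^ DIM('b))"
      using gaussian_dilation[OF Z, of "\<lambda>_. 1" l] that by (simp add: c_def emeasure_space_1)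
    finally show ?thesis by (simp add: c_def)
  qed
  have "I < \<infinity>"
  proof (rule ccontr)
    assume "\<not> I < \<infinity>"
    then have "I = \<top>" by (simp add: less_top[symmetric])
    then show False
      using bound[of 2] \<open>b > 0\<close> by (simp add: ennreal_mult_top top_unique)
  qed
  then show int: "integrable M (\<lambda>\<omega>. (norm (Z \<omega>))\<^sup>2)"
    unfolding I_def by (intro integrableI_nonneg) auto
  define E where "E = expectation (\<lambda>\<omega>. (norm (Z \<omega>))\<^sup>2)"
  have "E \<ge> 0" by (simp add: E_def)
  have I: "I = ennreal E"
    unfolding I_def E_def by (intro nn_integral_eq_integral int) auto
  have "b * E \<le> (l ^ DIM('b) - 1) / (1 - 1 / l\<^sup>2)" if "l > 1" for l :: real
  proof -
    have pos: "1 - 1 / l\<^sup>2 > 0"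
      using that by simp
    have "ennreal (1 + b * (1 - 1 / l\<^sup>2) * E) \<le> ennreal (l ^ DIM('b))"
      using bound[OF that] pos \<open>E \<ge> 0\<close> \<open>b > 0\<close> by (simp add: I ennreal_mult')
    then have "1 + b * (1 - 1 / l\<^sup>2) * E \<le> l ^ DIM('b)"
      using that by (subst (asm) ennreal_le_iff) auto
    then show ?thesis
      unfolding pos_le_divide_eq[OF pos] by (simp add: mult_ac)
  qed
  then have "b * E \<le> real DIM('b) / 2"
    by (intro tendsto_lowerbound[OF tendsto_mono[OF at_le power_quotient_tendsto, of "{1<..}" "DIM('b)"]])
       (auto simp: eventually_at_filter)
  then show "E \<le> DIM('b) / (2 * b)"
    using \<open>b > 0\<close> by (simp add: field_simps)
qed

section \<open>A lower bound for the mean norm\<close>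

lemma (in prob_space) integrable_reciprocal:
  fixes R :: "'a \<Rightarrow> real"
  assumes [measurable]: "R \<in> borel_measurable M" and "e > 0" and R: "\<And>\<omega>. R \<omega> \<ge> 0"
  shows "integrable M (\<lambda>\<omega>. 1 / (R \<omega> + e))"
proof (rule integrable_const_bound[where B = "1 / e"])
  have "1 / (R \<omega> + e) \<le> 1 / e" "0 \<le> 1 / (R \<omega> + e)" for \<omega>
    using R[of \<omega>] \<open>e > 0\<close> by (auto intro!: divide_left_mono mult_pos_pos add_nonneg_pos)
  then show "AE \<omega> in M. norm (1 / (R \<omega> + e)) \<le> 1 / e"
    by simp
qed measurable

text \<open>
  The virial inequality for \<open>1 / R\<close>, whose degree -1 turns the dimension \<open>d\<close> into \<open>d - 1\<close>.  Adding
  \<open>e\<close> in the denominator keeps the function bounded at the origin; what survives of homogeneity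
  is \<open>f(l z) \<le> f(z) / l\<close>, and this holds for \<open>l < 1\<close>, the side on which \<open>exp x \<ge> 1 + x\<close> with
  negative \<open>x\<close> estimates \<open>E f(Z)\<close> from above.
\<close>
lemma (in prob_space) gaussian_reciprocal_norm:
  fixes Z :: "'a \<Rightarrow> 'b::euclidean_space"
  assumes Z: "distributed M lborel Z (\<lambda>z. K * ennreal (exp (- b * (norm z)\<^sup>2)))"
    and "b > 0" and int: "integrable M (\<lambda>\<omega>. norm (Z \<omega>))" and "e > 0"
  shows "(DIM('b) - 1) / (2 * b) * expectation (\<lambda>\<omega>. 1 / (norm (Z \<omega>) + e))
          \<le> expectation (\<lambda>\<omega>. norm (Z \<omega>))"
proof -
  have [measurable]: "Z \<in> borel_measurable M"
    using Z by (simp add: distributed_def)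
  define A where "A = expectation (\<lambda>\<omega>. 1 / (norm (Z \<omega>) + e))"
  define m where "m = expectation (\<lambda>\<omega>. norm (Z \<omega>))"
  have m0: "m \<ge> 0" and A0: "A \<ge> 0"
    using \<open>e > 0\<close> by (simp_all add: m_def A_def)
  have "integrable M (\<lambda>\<omega>. 1 / (norm (Z \<omega>) + e))"
    using \<open>e > 0\<close> by (intro integrable_reciprocal) auto
  then have A: "(\<integral>\<^sup>+\<omega>. ennreal (1 / (norm (Z \<omega>) + e)) \<partial>M) = ennreal A"
    unfolding A_def using \<open>e > 0\<close> by (intro nn_integral_eq_integral) auto
  have m: "(\<integral>\<^sup>+\<omega>. ennreal (norm (Z \<omega>)) \<partial>M) = ennreal m"
    unfolding m_def by (intro nn_integral_eq_integral int) auto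
  have "A * ((l ^ (DIM('b) - 1) - 1) / (1 - 1 / l\<^sup>2)) \<le> b * m" if l: "0 < l" "l < 1" for l :: real
  proof -
    define c where "c = b * (1 / l\<^sup>2 - 1)"
    have pos: "1 / l\<^sup>2 - 1 > 0"
      using l by (simp add: field_simps power_less_one_iff)
    then have c: "c \<ge> 0"
      using \<open>b > 0\<close> by (simp add: c_def)
    \<comment> \<open>The inequality \<open>f \<le> exp (- c R\<^sup>2) f + c R\<^sup>2 f\<close> with \<open>R f \<le> 1\<close>, arranged so that all terms
        are nonnegative.\<close>
    have "ennreal A \<le> (\<integral>\<^sup>+\<omega>. ennreal (exp (- c * (norm (Z \<omega>))\<^sup>2)) * ennreal (1 / (norm (Z \<omega>) + e))
                          + ennreal c * ennreal (norm (Z \<omega>)) \<partial>M)"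
      unfolding A[symmetric]
    proof (intro nn_integral_mono)
      fix \<omega>
      define r where "r = norm (Z \<omega>)"
      have r: "r \<ge> 0" by (simp add: r_def)
      have "(1 - exp (- c * r\<^sup>2)) * (1 / (r + e)) \<le> c * r\<^sup>2 * (1 / (r + e))"
        using exp_ge_add_one_self[of "- c * r\<^sup>2"] r \<open>e > 0\<close> by (intro mult_right_mono) auto
      also have "\<dots> = c * (r * (r / (r + e)))"
        by (simp add: power2_eq_square)
      also have "\<dots> \<le> c * (r * 1)"
        using c r \<open>e > 0\<close> by (intro mult_left_mono) (auto simp: field_simps)
      finally have "1 / (r + e) \<le> exp (- c * r\<^sup>2) * (1 / (r + e)) + c * r"
        by (simp add: algebra_simps)
      then have "ennreal (1 / (r + e)) \<le> ennreal (exp (- c * r\<^sup>2) * (1 / (r + e)) + c * r)"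
        by (rule ennreal_leI)
      also have "\<dots> = ennreal (exp (- c * r\<^sup>2)) * ennreal (1 / (r + e)) + ennreal c * ennreal r"
        using c r \<open>e > 0\<close> by (simp only: ennreal_plus ennreal_mult exp_ge_zero zero_le_divide_1_iff
            mult_nonneg_nonneg add_nonneg_nonneg less_imp_le)
      finally show "ennreal (1 / (norm (Z \<omega>) + e))
          \<le> ennreal (exp (- c * (norm (Z \<omega>))\<^sup>2)) * ennreal (1 / (norm (Z \<omega>) + e))
             + ennreal c * ennreal (norm (Z \<omega>))"
        by (simp only: r_def)
    qed
    also have "\<dots> = (\<integral>\<^sup>+\<omega>. ennreal (exp (- c * (norm (Z \<omega>))\<^sup>2)) * ennreal (1 / (norm (Z \<omega>) + e)) \<partial>M)
                     + ennreal (c * m)"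
      using c m0 by (simp add: nn_integral_add nn_integral_cmult m ennreal_mult)
    also have "(\<integral>\<^sup>+\<omega>. ennreal (exp (- c * (norm (Z \<omega>))\<^sup>2)) * ennreal (1 / (norm (Z \<omega>) + e)) \<partial>M)
             = ennreal (l ^ DIM('b)) * (\<integral>\<^sup>+\<omega>. ennreal (1 / (norm (l *\<^sub>R Z \<omega>) + e)) \<partial>M)"
      using gaussian_dilation[OF Z, of "\<lambda>z. ennreal (1 / (norm z + e))" l] l
      by (simp add: c_def algebra_simps)
    also have "(\<integral>\<^sup>+\<omega>. ennreal (1 / (norm (l *\<^sub>R Z \<omega>) + e)) \<partial>M)
             \<le> (\<integral>\<^sup>+\<omega>. ennreal (1 / l) * ennreal (1 / (norm (Z \<omega>) + e)) \<partial>M)"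
    proof (intro nn_integral_mono)
      fix \<omega>
      have "l * (norm (Z \<omega>) + e) \<le> norm (l *\<^sub>R Z \<omega>) + e"
        using l \<open>e > 0\<close> by (simp add: algebra_simps)
      then have "1 / (norm (l *\<^sub>R Z \<omega>) + e) \<le> 1 / (l * (norm (Z \<omega>) + e))"
        using l \<open>e > 0\<close> by (intro divide_left_mono) (auto intro!: mult_pos_pos add_nonneg_pos)
      then show "ennreal (1 / (norm (l *\<^sub>R Z \<omega>) + e)) \<le> ennreal (1 / l) * ennreal (1 / (norm (Z \<omega>) + e))"
        using l \<open>e > 0\<close> by (simp add: ennreal_mult'[symmetric] ennreal_leI)
    qed
    also have "\<dots> = ennreal (1 / l) * ennreal A"
      by (subst nn_integral_cmult) (measurable, simp only: A)
    also have "\<dots> = ennreal (A / l)"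
      using l by (simp add: ennreal_mult'[symmetric])
    finally have "ennreal A \<le> ennreal (l ^ DIM('b)) * ennreal (A / l) + ennreal (c * m)"
      by (simp add: add_right_mono mult_left_mono)
    also have "\<dots> = ennreal (l ^ DIM('b) * (A / l) + c * m)"
      using l A0 c m0 by (simp add: ennreal_mult'[symmetric])
    also have "l ^ DIM('b) * (A / l) = l ^ (DIM('b) - 1) * A"
      using l by (simp add: power_diff)
    finally have "A \<le> l ^ (DIM('b) - 1) * A + c * m"
      using l A0 c m0 by (subst (asm) ennreal_le_iff) auto
    then have "A * (1 - l ^ (DIM('b) - 1)) / (1 / l\<^sup>2 - 1) \<le> b * m"
      unfolding pos_divide_le_eq[OF pos] by (simp add: c_def algebra_simps)
    also have "A * (1 - l ^ (DIM('b) - 1)) / (1 / l\<^sup>2 - 1)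
             = A * ((l ^ (DIM('b) - 1) - 1) / (1 - 1 / l\<^sup>2))"
      by (metis minus_diff_eq minus_divide_divide times_divide_eq_right)
    finally show ?thesis .
  qed
  moreover have "\<forall>\<^sub>F l::real in at_left 1. 0 < l"
    by (rule order_tendstoD) (auto intro!: tendsto_intros)
  ultimately have "\<forall>\<^sub>F l in at_left 1. A * ((l ^ (DIM('b) - 1) - 1) / (1 - 1 / l\<^sup>2)) \<le> b * m"
    by (auto simp: eventually_at_filter elim: eventually_mono)
  then have "A * (real (DIM('b) - 1) / 2) \<le> b * m"
    by (intro tendsto_upperbound[OF tendsto_mult_left[OF
            tendsto_mono[OF at_le power_quotient_tendsto, of "{..<1}"]]]) auto
  then show "(DIM('b) - 1) / (2 * b) * A \<le> m"
    using \<open>b > 0\<close> by (simp add: field_simps)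
qed

text \<open>
  Jensen's inequality for the convex function \<open>1 / x\<close>, by integrating its tangent line at the
  mean \<open>s\<close> of \<open>R + e\<close>.
\<close>
lemma (in prob_space) reciprocal_expectation_le:
  fixes R :: "'a \<Rightarrow> real"
  assumes int: "integrable M R" and "e > 0" and "\<And>\<omega>. R \<omega> \<ge> 0"
  shows "1 / (expectation R + e) \<le> expectation (\<lambda>\<omega>. 1 / (R \<omega> + e))"
proof -
  have [measurable]: "R \<in> borel_measurable M"
    using int by simp
  define s where "s = expectation R + e"
  have s: "s > 0"
    using assms by (auto simp: s_def intro!: add_nonneg_pos)
  have "1 / s = expectation (\<lambda>\<omega>. 2 / s - (R \<omega> + e) / s\<^sup>2)"
    proof -
    have "expectation (\<lambda>\<omega>. 2 / s - (R \<omega> + e) / s\<^sup>2) = 2 / s - s / s\<^sup>2"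
      using int by (simp add: prob_space s_def)
    then show ?thesis
      using s by (simp add: power2_eq_square)
  qed
  also have "\<dots> \<le> expectation (\<lambda>\<omega>. 1 / (R \<omega> + e))"
  proof (rule integral_mono)
    show "integrable M (\<lambda>\<omega>. 1 / (R \<omega> + e))"
      using assms by (intro integrable_reciprocal) auto
    fix \<omega>
    have r: "R \<omega> + e > 0"
      using assms by (intro add_nonneg_pos)
    have "1 / (R \<omega> + e) - (2 / s - (R \<omega> + e) / s\<^sup>2) = (R \<omega> + e - s)\<^sup>2 / (s\<^sup>2 * (R \<omega> + e))"
      using s r by (simp add: field_simps power2_eq_square)
    also have "\<dots> \<ge> 0" using s r by simp
    finally show "2 / s - (R \<omega> + e) / s\<^sup>2 \<le> 1 / (R \<omega> + e)" by simp
  qed (use int in auto)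
  finally show ?thesis by (simp add: s_def)
qed

lemma (in prob_space) gaussian_mean_norm_lower_bound:
  fixes Z :: "'a \<Rightarrow> 'b::euclidean_space"
  assumes Z: "distributed M lborel Z (\<lambda>z. K * ennreal (exp (- b * (norm z)\<^sup>2)))"
    and "b > 0" and int: "integrable M (\<lambda>\<omega>. norm (Z \<omega>))"
  shows "(DIM('b) - 1) / (2 * b) \<le> (expectation (\<lambda>\<omega>. norm (Z \<omega>)))\<^sup>2"
proof -
  define m where "m = expectation (\<lambda>\<omega>. norm (Z \<omega>))"
  define k where "k = (DIM('b) - 1) / (2 * b)"
  have m0: "m \<ge> 0" by (simp add: m_def)
  have k0: "k \<ge> 0" using \<open>b > 0\<close> by (simp add: k_def)
  have "k \<le> m * (m + e)" if "e > 0" for e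
  proof -
    have "k * (1 / (m + e)) \<le> k * expectation (\<lambda>\<omega>. 1 / (norm (Z \<omega>) + e))"
      unfolding m_def using k0 that by (intro mult_left_mono reciprocal_expectation_le int) auto
    also have "\<dots> \<le> m"
      unfolding m_def k_def using gaussian_reciprocal_norm[OF Z \<open>b > 0\<close> int that] .
    finally show ?thesis
      using m0 that by (simp add: field_simps)
  qed
  moreover have "((\<lambda>e. m * (m + e)) \<longlongrightarrow> m * (m + 0)) (at_right 0)"
    by (intro tendsto_intros)
  ultimately have "k \<le> m * (m + 0)"
    by (intro tendsto_lowerbound) (auto simp: eventually_at_filter)
  then show "k \<le> m\<^sup>2"
    by (simp add: power2_eq_square)
qed

section \<open>The distance of two independent Gaussian vectors\<close>

theorem theorem1p3:
  fixes M :: "'a measure" and X Y :: "'a \<Rightarrow> real ^ 'n"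
  assumes "prob_space M"
    and "distributed M lborel X (\<lambda>x. ennreal (std_gaussian_density x))"
    and "distributed M lborel Y (\<lambda>x. ennreal (std_gaussian_density x))"
    and "prob_space.indep_var M borel X borel Y"
  shows "(integrable M (\<lambda>\<omega>. norm (X \<omega> - Y \<omega>) - sqrt (2 * real CARD('n))) \<and>
          prob_space.expectation M (\<lambda>\<omega>. norm (X \<omega> - Y \<omega>) - sqrt (2 * real CARD('n)))
            \<le> 1 / sqrt (2 * real CARD('n))) \<and>
        (integrable M (\<lambda>\<omega>. (norm (X \<omega> - Y \<omega>))\<^sup>2) \<and>
          prob_space.variance M (\<lambda>\<omega>. norm (X \<omega> - Y \<omega>)) \<le> 3)"
proof -
  interpret prob_space M by fact
  let ?R = "\<lambda>\<omega>. norm (X \<omega> - Y \<omega>)"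
  obtain K where Z: "distributed M lborel (\<lambda>\<omega>. X \<omega> - Y \<omega>)
                     (\<lambda>z. K * ennreal (exp (- (1/4) * (norm z)\<^sup>2)))"
    using difference_of_std_gaussians assms by blast
  have sq: "integrable M (\<lambda>\<omega>. (?R \<omega>)\<^sup>2)" "expectation (\<lambda>\<omega>. (?R \<omega>)\<^sup>2) \<le> 2 * real CARD('n)"
    using gaussian_second_moment[OF Z] by simp_all
  have [measurable]: "X \<in> borel_measurable M" "Y \<in> borel_measurable M"
    using assms(2,3) by (simp_all add: distributed_def)
  have int: "integrable M ?R"
    by (rule square_integrable_imp_integrable[OF _ sq(1)]) measurable
  have lower: "2 * real CARD('n) - 2 \<le> (expectation ?R)\<^sup>2"
    using gaussian_mean_norm_lower_bound[OF Z _ int] by (simp add: of_nat_diff)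
  have var: "variance ?R = expectation (\<lambda>\<omega>. (?R \<omega>)\<^sup>2) - (expectation ?R)\<^sup>2"
    using int sq(1) by (rule variance_eq)
  have "(expectation ?R)\<^sup>2 \<le> 2 * real CARD('n)"
    using var variance_positive[of ?R] sq(2) by linarith
  then have "expectation ?R \<le> sqrt (2 * real CARD('n))"
    by (rule real_le_rsqrt)
  then have "expectation (\<lambda>\<omega>. ?R \<omega> - sqrt (2 * real CARD('n))) \<le> 0"
    using int by (simp add: prob_space)
  also have "0 \<le> 1 / sqrt (2 * real CARD('n))"
    by simp
  finally show ?thesis
    using int sq lower var by simp
qed

end
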